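(* The Zimin word $Z$ admits no suffix having a super-monochromatic factorisation with respect to the coloring $C$ of $\mathcal{A}_x^+$ described in the context.
   Context: Alphabet $\mathcal{A}_x=\{x_1,x_2,\ldots\}$; $Z_1=x_1$, $Z_{m+1}=Z_mx_{m+1}Z_m$, $Z=\lim Z_m=x_1x_2x_1x_3x_1x_2x_1x_4\ldots$. For a factor $u$ of $Z$ (nonempty finite word occurring in $Z$), $k(u)=\max\{k:x_k\text{ occurs in }u\}$. $u_1=v_1=x_1$, $u_{m+1}=x_{m+1}u_1\cdots u_m$, $v_{m+1}=v_m\cdots v_1x_{m+1}$; $[a,b[=\{a,\ldots,b-1\}$; for finite $A=\{i_1<\cdots<i_k\}$, $u_A=u_{i_1}\cdots u_{i_k}$ and for $B=\{j_1<\cdots<j_k\}$, $v_B=v_{j_k}\cdots v_{j_1}$ (empty products are empty). Every factor $u$ of $Z$ is uniquely $u=u_Ax_{k(u)}v_B$ with $A,B\subset[1,k(u)[$; set $\eta(u)=\max([1,k(u)[\setminus A)$, or $\eta(u)=0$ if $A=[1,k(u)[$. The coloring $C$: for a factor $u$ of $Z$, $C(u)=\textbf{red}$ if $A\cap[1,\eta(u)[=[1,\eta(u)[\setminus(B\cap[1,\eta(u)[)$ and $C(u)=\textbf{blue}$ otherwise; for a non-factor $u$ of $Z$, $C(u)=\textbf{red}$ if every decomposition of $u$ as a concatenation of factors of $Z$ has at least three terms, and $C(u)=\textbf{blue}$ if $u$ is a concatenation of two factors of $Z$. A factorisation $y=w_1w_2\ldots$ (nonempty finite $w_i$) is super-monochromatic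 if $C$ is constant on $\{w_{n_1}\cdots w_{n_k}: k\geq1, n_1<\cdots<n_k\}$. A suffix of $Z=z_0z_1\ldots$ is $z_kz_{k+1}\ldots$, $k\geq0$. *)

theory Defs
  imports "HOL-Library.Omega_Words_Fun"
begin

text \<open>
  The letter \<open>x\<^sub>k\<close> (\<open>k \<ge> 1\<close>) is encoded as the number \<open>k\<close>; the number \<open>0\<close> is not a letter
  and never occurs in a Zimin word. So \<open>\<A>\<^sub>x\<^sup>+\<close> consists of the nonempty lists of
  positive numbers. Infinite words are functions on \<open>nat\<close>.
\<close>

fun zimin :: "nat \<Rightarrow> nat list" where
  "zimin 0 = []"
| "zimin (Suc m) = zimin m @ [Suc m] @ zimin m"

text \<open>The limit of the words \<open>zimin m\<close>; see \<open>prefix_zimin_word\<close> below.\<close>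

definition zimin_word :: "nat word" where
  "zimin_word n = zimin (Suc n) ! n"

lemma length_zimin: "length (zimin m) = 2 ^ m - 1"
proof (induction m)
  case (Suc m)
  moreover have "(1::nat) \<le> 2 ^ m" by simp
  ultimately show ?case by simp
qed simp

lemma zimin_nth_mono:
  assumes "m \<le> n" "i < length (zimin m)"
  shows "zimin n ! i = zimin m ! i"
  using assms
proof (induction n rule: dec_induct)
  case (step n)
  have "length (zimin m) \<le> length (zimin n)"
    using step.hyps by (simp add: length_zimin diff_le_mono)
  with step show ?case by (simp add: nth_append)
qed simp

lemma prefix_zimin_word: "prefix (length (zimin m)) zimin_word = zimin m"
proof (rule nth_equalityI)
  fix i assume "i < length (prefix (length (zimin m)) zimin_word)"
  then have i: "i < length (zimin m)" by simp
  have "Suc i < 2 ^ Suc i" by (rule less_exp)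
  then have i': "i < length (zimin (Suc i))" unfolding length_zimin by linarith
  have "zimin (Suc i) ! i = zimin m ! i"
  proof (cases "m \<le> Suc i")
    case True
    then show ?thesis using i by (rule zimin_nth_mono)
  next
    case False
    then show ?thesis using zimin_nth_mono[OF _ i', of m] by simp
  qed
  then show "prefix (length (zimin m)) zimin_word ! i = zimin m ! i"
    using i by (simp add: zimin_word_def)
qed simp

definition zimin_factor :: "nat list \<Rightarrow> bool" where
  "zimin_factor u \<longleftrightarrow> u \<noteq> [] \<and> (\<exists>i j. u = zimin_word [i \<rightarrow> j])"

definition max_letter :: "nat list \<Rightarrow> nat" where
  "max_letter u = Max (set u)"

function u_word :: "nat \<Rightarrow> nat list" where
  "u_word m = m # concat (map u_word [1..<m])"
  by pat_completeness auto
termination by (relation "measure id") auto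

function v_word :: "nat \<Rightarrow> nat list" where
  "v_word m = concat (map v_word (rev [1..<m])) @ [m]"
  by pat_completeness auto
termination by (relation "measure id") auto

declare u_word.simps [simp del] v_word.simps [simp del]

definition u_prod :: "nat set \<Rightarrow> nat list" where
  "u_prod A = concat (map u_word (sorted_list_of_set A))"

definition v_prod :: "nat set \<Rightarrow> nat list" where
  "v_prod B = concat (map v_word (rev (sorted_list_of_set B)))"

definition zimin_decomp :: "nat list \<Rightarrow> nat set \<times> nat set \<Rightarrow> bool" where
  "zimin_decomp u = (\<lambda>(A, B). A \<subseteq> {1..<max_letter u} \<and> B \<subseteq> {1..<max_letter u} \<and>
     u = u_prod A @ [max_letter u] @ v_prod B)"

text \<open>Meaningful for factors only, where the decomposition exists and is unique.\<close>

definition left_set :: "nat list \<Rightarrow> nat set" where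
  "left_set u = fst (THE p. zimin_decomp u p)"

definition right_set :: "nat list \<Rightarrow> nat set" where
  "right_set u = snd (THE p. zimin_decomp u p)"

definition eta :: "nat list \<Rightarrow> nat" where
  "eta u = (if left_set u = {1..<max_letter u} then 0
            else Max ({1..<max_letter u} - left_set u))"

datatype color = Red | Blue

definition zimin_coloring :: "nat list \<Rightarrow> color" where
  "zimin_coloring u =
     (if zimin_factor u then
        (if left_set u \<inter> {1..<eta u} = {1..<eta u} - (right_set u \<inter> {1..<eta u})
         then Red else Blue)
      else
        (if \<forall>us. (\<forall>f\<in>set us. zimin_factor f) \<and> concat us = u \<longrightarrow> length us \<ge> 3
         then Red else Blue))"

text \<open>On nonempty non-factors, the last alternative is the one of the concatenations of two factors.\<close>

lemma zimin_coloring_non_factor: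
  assumes "u \<noteq> []" "\<not> zimin_factor u"
  shows "zimin_coloring u = Blue \<longleftrightarrow> (\<exists>f g. zimin_factor f \<and> zimin_factor g \<and> u = f @ g)"
proof
  assume "zimin_coloring u = Blue"
  then obtain us where us: "\<forall>f\<in>set us. zimin_factor f" "concat us = u" "length us < 3"
    using assms by (auto simp: zimin_coloring_def not_le split: if_splits)
  have "us \<noteq> []" using us(2) assms(1) by auto
  moreover have "length us \<noteq> 1"
    using us assms(2) by (auto simp: length_Suc_conv)
  ultimately have "length us = 2" using us(3) by (cases "length us") auto
  then obtain f g where "us = [f, g]" by (auto simp: numeral_2_eq_2 length_Suc_conv)
  with us show "\<exists>f g. zimin_factor f \<and> zimin_factor g \<and> u = f @ g" by auto
next
  assume "\<exists>f g. zimin_factor f \<and> zimin_factor g \<and> u = f @ g"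
  then obtain f g where "zimin_factor f" "zimin_factor g" "u = f @ g" by blast
  then have "\<not> (\<forall>us. (\<forall>f\<in>set us. zimin_factor f) \<and> concat us = u \<longrightarrow> length us \<ge> 3)"
    by (auto intro!: exI[of _ "[f, g]"])
  then show "zimin_coloring u = Blue" using assms(2) by (simp add: zimin_coloring_def)
qed

text \<open>The blocks \<open>w\<^sub>1, w\<^sub>2, \<dots>\<close> are indexed from \<open>0\<close>.\<close>

definition factorisation :: "'a word \<Rightarrow> (nat \<Rightarrow> 'a list) \<Rightarrow> bool" where
  "factorisation y w \<longleftrightarrow> (\<forall>i. w i \<noteq> []) \<and>
     (\<forall>n. let p = concat (map w [0..<n]) in p = prefix (length p) y)"

definition super_monochromatic :: "('a list \<Rightarrow> 'c) \<Rightarrow> (nat \<Rightarrow> 'a list) \<Rightarrow> bool" where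
  "super_monochromatic C w \<longleftrightarrow>
     (\<exists>c. \<forall>u \<in> {concat (map w ns) | ns. ns \<noteq> [] \<and> sorted_wrt (<) ns}. C u = c)"

end

theory Submission
  imports Defs "HOL-Library.Nat_Bijection"
begin

text \<open>
  The \<open>n\<close>-th letter of \<open>Z\<close> (\<open>n \<ge> 1\<close>) has index one more than the 2-adic valuation of \<open>n\<close>. So a
  factor \<open>xs x\<^sub>k ys\<close> with maximal letter \<open>x\<^sub>k\<close> has \<open>|xs|, |ys| < 2\<^bsup>k-1\<^esup>\<close>, and its sets \<open>A\<close>, \<open>B\<close> are
  the binary digits of \<open>|xs|\<close>, \<open>|ys|\<close>. Writing \<open>D = 2\<^bsup>k-1\<^esup> - 1 - |xs|\<close> and \<open>2\<^sup>e \<le> D < 2\<^bsup>e+1\<^esup>\<close>, one gets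
  \<open>\<eta> = e + 1\<close>, and the factor is red iff \<open>2\<^sup>e\<close> divides its length. For a block of \<open>Z\<close> from position
  \<open>a\<close> (exclusive) that contains a power of 2, \<open>D = a\<close>.

  Red case: let \<open>W\<close> be a late group of consecutive blocks containing a power of 2. Then \<open>w\<^sub>1 W\<close>,
  a concatenation of two factors, must itself be a factor, with \<open>D\<close> diminished by \<open>|w\<^sub>1|\<close> only.
  Hence a large power of 2 divides both \<open>|W|\<close> and \<open>|w\<^sub>1| + |W|\<close>, so also \<open>|w\<^sub>1|\<close>.

  Blue case: group the blocks into \<open>W\<^sub>1, \<dots>, W\<^sub>5\<close>, each containing a power of 2, and let \<open>2\<^sup>e\<close> be the
  largest power of 2 in \<open>W\<^sub>1\<close>. Blueness of \<open>W\<^sub>2\<close> says that \<open>2\<^sup>e\<close> does not divide \<open>|W\<^sub>2|\<close>, so omitting \<open>W\<^sub>2\<close> puts the maximal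
  letters of \<open>W\<^sub>1\<close> and \<open>W\<^sub>3\<close> at a distance that is impossible inside a factor; likewise for \<open>W\<^sub>3\<close>,
  \<open>W\<^sub>5\<close>. If \<open>W\<^sub>1 W\<^sub>3 W\<^sub>5\<close> were cut into at most two factors, one of them would contain one of these
  pairs of letters.
\<close>

section \<open>Letters of Z and divisibility by powers of 2\<close>

text \<open>In \<open>zimin (Suc m)\<close> the second copy of \<open>zimin m\<close> is shifted by
  \<open>2 ^ m\<close>, and adding \<open>2 ^ m\<close> to a positive number below
  \<open>2 ^ m\<close> keeps its valuation. List indices start at \<open>0\<close>, hence
  \<open>Suc i\<close>.\<close>

lemma less_zimin_nth_iff:
  assumes "i < length (zimin m)"
  shows "e < zimin m ! i \<longleftrightarrow> 2 ^ e dvd Suc i"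
  using assms
proof (induction m arbitrary: i)
  case (Suc m)
  have len: "Suc (length (zimin m)) = 2 ^ m" by (simp add: length_zimin)
  consider "i < length (zimin m)" | "i = length (zimin m)"
    | j where "i = Suc (length (zimin m)) + j" "j < length (zimin m)"
  proof (cases "i \<le> length (zimin m)")
    case False
    then obtain j where "i = Suc (length (zimin m)) + j"
      by (metis Suc_leI le_Suc_ex not_le)
    with Suc.prems show ?thesis by (intro that(3)) auto
  qed (use that in linarith)
  then show ?case
  proof cases
    case 1
    then show ?thesis using Suc.IH by (simp add: nth_append)
  next
    case 2
    then show ?thesis using len by (simp add: nth_append dvd_power_iff_le less_Suc_eq_le)
  next
    case 3
    have j: "Suc j < 2 ^ m" using 3 len by linarith
    have "2 ^ e dvd Suc j \<longleftrightarrow> 2 ^ e dvd Suc i"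
    proof (cases "e \<le> m")
      case True
      then have "(2::nat) ^ e dvd 2 ^ m" by (rule le_imp_power_dvd)
      moreover have "Suc i = 2 ^ m + Suc j" using 3 len by simp
      ultimately show ?thesis by (metis dvd_add_right_iff)
    next
      case False
      then have "(2::nat) ^ Suc m \<le> 2 ^ e" by (intro power_increasing) auto
      moreover have "Suc i = 2 ^ m + Suc j" using 3 len by simp
      ultimately have "Suc j < 2 ^ e" "Suc i < 2 ^ e" using j by auto
      then show ?thesis by (meson dvd_imp_le not_less zero_less_Suc)
    qed
    moreover have "zimin (Suc m) ! i = zimin m ! j"
      using 3 by (simp add: nth_append)
    ultimately show ?thesis using Suc.IH 3 by simp
  qed
qed simp

lemma less_zimin_word_iff: "e < zimin_word n \<longleftrightarrow> 2 ^ e dvd Suc n"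
proof -
  have "Suc n < 2 ^ Suc n" by (rule less_exp)
  then have "n < length (zimin (Suc n))" unfolding length_zimin by linarith
  then show ?thesis unfolding zimin_word_def by (rule less_zimin_nth_iff)
qed

lemma zimin_word_eqI:
  assumes "\<And>e. 2 ^ e dvd Suc i \<longleftrightarrow> 2 ^ e dvd Suc j"
  shows "zimin_word i = zimin_word j"
  using assms unfolding less_zimin_word_iff[symmetric]
  by (metis linorder_neqE_nat less_irrefl)

lemma zimin_word_power: "zimin_word (2 ^ t - 1) = Suc t"
proof -
  have *: "e < zimin_word (2 ^ t - 1) \<longleftrightarrow> e < Suc t" for e
    by (simp add: less_zimin_word_iff dvd_power_iff_le less_Suc_eq_le)
  show ?thesis using *[of t] *[of "Suc t"] by simp
qed

section \<open>Factors of Z around their maximal letter\<close>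

lemma zimin_factor_nth:
  assumes "zimin_factor u"
  obtains i where "\<And>n. n < length u \<Longrightarrow> u ! n = zimin_word (i + n)"
proof -
  obtain i j where "u = zimin_word [i \<rightarrow> j]" using assms by (auto simp: zimin_factor_def)
  then show thesis using that[of i] by simp
qed

lemma power_dvd_add_iff:
  fixes P d :: nat
  assumes "2 ^ n dvd P" "0 < d" "d < 2 ^ n"
  shows "2 ^ e dvd P + d \<longleftrightarrow> 2 ^ e dvd d"
proof (cases "e \<le> n")
  case True
  then have "2 ^ e dvd P" using assms(1) power_le_dvd by blast
  then show ?thesis by (simp add: dvd_add_right_iff)
next
  case False
  then have "n \<le> e" by simp
  have "\<not> 2 ^ n dvd d" using assms by (simp add: nat_dvd_not_less)
  moreover then have "\<not> 2 ^ n dvd P + d" using assms(1) by (simp add: dvd_add_right_iff)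
  ultimately show ?thesis using \<open>n \<le> e\<close> power_le_dvd by blast
qed

lemma power_dvd_diff_iff:
  fixes P d :: nat
  assumes "2 ^ n dvd P" "0 < d" "d < 2 ^ n" "d < P"
  shows "2 ^ e dvd P - d \<longleftrightarrow> 2 ^ e dvd d"
proof (cases "e \<le> n")
  case True
  then have "2 ^ e dvd P" using assms(1) power_le_dvd by blast
  then show ?thesis using assms by (metis dvd_diffD1 dvd_diff_nat less_imp_le_nat)
next
  case False
  then have "n \<le> e" by simp
  have "\<not> 2 ^ n dvd d" using assms by (simp add: nat_dvd_not_less)
  moreover then have "\<not> 2 ^ n dvd P - d" using assms by (metis dvd_diffD1 less_imp_le_nat)
  ultimately show ?thesis using \<open>n \<le> e\<close> power_le_dvd by blast
qed

text \<open>The letter \<open>Suc t\<close> sits at a position P divisible by \<open>2 ^ t\<close>.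
  At distance \<open>2 ^ t\<close> from it another letter above \<open>t\<close> would appear. At
  smaller distances d, the numbers P + d and P - d have the valuation of d, so the right side reads
  the beginning of Z and the left side its reversal.\<close>

lemma zimin_factor_split:
  assumes "zimin_factor (xs @ [Suc t] @ ys)" "\<forall>x\<in>set xs \<union> set ys. x \<le> t"
  shows "xs = rev (prefix (length xs) zimin_word)" "ys = prefix (length ys) zimin_word"
    "length xs < 2 ^ t" "length ys < 2 ^ t"
proof -
  obtain i where i: "\<And>n. n < length (xs @ [Suc t] @ ys)
      \<Longrightarrow> (xs @ [Suc t] @ ys) ! n = zimin_word (i + n)"
    using zimin_factor_nth[OF assms(1)] by blast
  define P where "P = Suc (i + length xs)"
  have P: "2 ^ t dvd P"
    using i[of "length xs"] less_zimin_word_iff[of t "i + length xs"] by (simp add: P_def)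
  have xs: "xs ! n = zimin_word (i + n)" if "n < length xs" for n
    using i[of n] that by (simp add: nth_append)
  have ys: "ys ! n = zimin_word (P + n)" if "n < length ys" for n
    using i[of "Suc (length xs + n)"] that by (simp add: nth_append P_def add_ac)
  show lx: "length xs < 2 ^ t"
  proof (rule ccontr)
    assume "\<not> length xs < 2 ^ t"
    then have le: "2 ^ t \<le> length xs" by simp
    let ?n = "length xs - 2 ^ t"
    have n: "?n < length xs" using le by (intro diff_less) (auto intro: less_le_trans[of 0 "2 ^ t"])
    have "Suc (i + ?n) = P - 2 ^ t" using le by (simp add: P_def)
    then have "t < xs ! ?n" using P xs[OF n] less_zimin_word_iff[of t "i + ?n"] by simp
    then show False using assms(2) n by (metis UnI1 leD nth_mem)
  qed
  show ly: "length ys < 2 ^ t"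
  proof (rule ccontr)
    assume "\<not> length ys < 2 ^ t"
    then have n: "2 ^ t - 1 < length ys" by (simp add: not_less Suc_le_lessD Suc_le_eq)
    have "t < ys ! (2 ^ t - 1)"
      using P ys[OF n] less_zimin_word_iff[of t "P + (2 ^ t - 1)"] by simp
    then show False using assms(2) n by (metis UnI2 leD nth_mem)
  qed
  show "ys = prefix (length ys) zimin_word"
  proof (rule nth_equalityI)
    fix n assume n: "n < length ys"
    have "zimin_word (P + n) = zimin_word n"
      using power_dvd_add_iff[OF P, of "Suc n"] n ly by (intro zimin_word_eqI) simp
    then show "ys ! n = prefix (length ys) zimin_word ! n" using ys n by simp
  qed simp
  show "xs = rev (prefix (length xs) zimin_word)"
  proof (rule nth_equalityI)
    fix n assume n: "n < length xs"
    have eq: "Suc (i + n) = P - Suc (length xs - Suc n)" using n by (simp add: P_def)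
    have "zimin_word (i + n) = zimin_word (length xs - Suc n)"
    proof (rule zimin_word_eqI)
      fix e show "2 ^ e dvd Suc (i + n) \<longleftrightarrow> 2 ^ e dvd Suc (length xs - Suc n)"
        unfolding eq using n lx by (intro power_dvd_diff_iff[OF P]) (auto simp: P_def)
    qed
    then show "xs ! n = rev (prefix (length xs) zimin_word) ! n" using xs n by (simp add: rev_nth)
  qed simp
qed

section \<open>The products of the u and v words as prefixes of Z\<close>

lemma rev_zimin: "rev (zimin m) = zimin m"
  by (induction m) auto

lemma concat_v_word: "concat (map v_word (rev [1..<Suc m])) = zimin m"
proof (induction m)
  case (Suc m)
  have "v_word (Suc m) = zimin m @ [Suc m]" using Suc by (subst v_word.simps) simp
  then show ?case using Suc by simp
qed simp

lemma v_word_Suc: "v_word (Suc m) = zimin m @ [Suc m]"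
  by (subst v_word.simps) (simp only: concat_v_word)

lemma concat_u_word: "concat (map u_word [1..<Suc m]) = zimin m"
proof (induction m)
  case (Suc m)
  have "u_word (Suc m) = Suc m # zimin m" using Suc by (subst u_word.simps) simp
  then show ?case using Suc by simp
qed simp

lemma u_word_Suc: "u_word (Suc m) = Suc m # zimin m"
  by (subst u_word.simps) (simp only: concat_u_word)

lemma rev_v_prod:
  assumes "0 \<notin> B" "finite B"
  shows "rev (v_prod B) = u_prod B"
proof -
  have "rev (v_word b) = u_word b" if "b \<in> B" for b
    using that assms(1) by (cases b) (auto simp: v_word_Suc u_word_Suc rev_zimin)
  then show ?thesis
    using assms(2) by (auto simp: v_prod_def u_prod_def rev_concat rev_map intro!: arg_cong[where f = concat])
qed

lemma v_prod_insert_max: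
  assumes "finite B" "\<forall>a\<in>B. a < b"
  shows "v_prod (insert b B) = v_word b @ v_prod B"
proof -
  have "sorted_list_of_set (insert b B) = sorted_list_of_set B @ [b]"
    using assms by (intro sorted_distinct_set_unique)
      (auto simp: sorted_append less_imp_le simp del: sorted_list_of_set_insert_remove)
  then show ?thesis by (simp add: v_prod_def)
qed

lemma zimin_word_Suc_shift:
  assumes "i < 2 ^ m - 1"
  shows "zimin_word (2 ^ m + i) = zimin_word i"
  using power_dvd_add_iff[of m "2 ^ m" "Suc i"] assms by (intro zimin_word_eqI) simp

text \<open>\<open>v_word (Suc b)\<close> is the prefix of Z of length \<open>2 ^ b\<close>, after
  which Z repeats its first \<open>2 ^ b - 1\<close> letters. So prepending the word of the largest
  index amounts to adding a leading binary digit to the length. Digits start at \<open>0\<close> and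
  letters at \<open>1\<close>, hence the image under \<open>Suc\<close>.\<close>

lemma v_prod_Suc_image:
  assumes "finite B"
  shows "v_prod (Suc ` B) = prefix (set_encode B) zimin_word"
  using assms
proof (induction B rule: finite_linorder_max_induct)
  case empty
  then show ?case by (simp add: v_prod_def)
next
  case (insert b B)
  have "B \<subseteq> {..<b}" using insert.hyps by auto
  then have "set_encode B \<le> set_encode {..<b}"
    unfolding set_encode_def by (intro sum_mono2) auto
  also have "\<dots> = 2 ^ b - 1" unfolding set_encode_def by (simp only: lessThan_atLeast0 sum_power2)
  finally have le: "set_encode B \<le> 2 ^ b - 1" .
  have "prefix (2 ^ b) zimin_word = zimin b @ [Suc b]"
  proof -
    have "prefix (2 ^ b) zimin_word = prefix (Suc (2 ^ b - 1)) zimin_word" by simp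
    also have "\<dots> = prefix (2 ^ b - 1) zimin_word @ [zimin_word (2 ^ b - 1)]"
      by (simp add: subsequence_def del: Suc_pred)
    finally show ?thesis
      using prefix_zimin_word[of b] zimin_word_power[of b] by (simp add: length_zimin)
  qed
  moreover have "prefix (2 ^ b + set_encode B) zimin_word
      = prefix (2 ^ b) zimin_word @ prefix (set_encode B) zimin_word"
    using le zimin_word_Suc_shift[of _ b]
    by (intro nth_equalityI) (auto simp: nth_append, metis add_diff_inverse_nat less_diff_conv2 not_less order_less_le_trans add.commute nat_add_left_cancel_less)
  moreover have "v_prod (Suc ` insert b B) = v_word (Suc b) @ v_prod (Suc ` B)"
    using insert.hyps by (simp add: v_prod_insert_max)
  moreover have "set_encode (insert b B) = 2 ^ b + set_encode B"
    using insert.hyps by (auto simp: set_encode_insert)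
  ultimately show ?case using insert.IH by (simp add: v_word_Suc)
qed

lemma u_prod_Suc_image:
  assumes "finite A"
  shows "u_prod (Suc ` A) = rev (prefix (set_encode A) zimin_word)"
  using rev_v_prod[of "Suc ` A"] assms by (simp add: v_prod_Suc_image)

section \<open>The color of a factor as a divisibility condition\<close>

text \<open>Complementary low digits add up without carry to \<open>2 ^ e - 1\<close>. The induction
  peels off the last digit of both numbers.\<close>

lemma set_decode_complementary_iff:
  "(\<forall>i<e. i \<in> set_decode a \<longleftrightarrow> i \<notin> set_decode b) \<longleftrightarrow> 2 ^ e dvd Suc (a + b)"
proof (induction e arbitrary: a b)
  case (Suc e)
  have "(\<forall>i<Suc e. i \<in> set_decode a \<longleftrightarrow> i \<notin> set_decode b) \<longleftrightarrow>
      (odd a \<longleftrightarrow> even b) \<and> 2 ^ e dvd Suc (a div 2 + b div 2)"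
    unfolding All_less_Suc2 Suc.IH[symmetric] by simp
  also have "\<dots> \<longleftrightarrow> 2 ^ Suc e dvd Suc (a + b)"
  proof (cases "odd a \<longleftrightarrow> even b")
    case True
    then have "Suc (a + b) = 2 * Suc (a div 2 + b div 2)" by (auto elim!: evenE oddE)
    then show ?thesis using True by (simp del: mult_Suc_right)
  next
    case False
    then have "\<not> 2 dvd Suc (a + b)" by auto
    then have "\<not> 2 ^ Suc e dvd Suc (a + b)" by (metis dvd_mult_left power_Suc)
    then show ?thesis using False by simp
  qed
  finally show ?case .
qed simp

lemma set_decode_subset_lessThan:
  assumes "n < 2 ^ t"
  shows "set_decode n \<subseteq> {..<t}"
proof
  fix i assume "i \<in> set_decode n"
  then have "n div 2 ^ i \<noteq> 0" by (auto simp: set_decode_def intro: odd_pos)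
  then have "2 ^ i \<le> n" by (simp add: div_eq_0_iff)
  with assms have "(2::nat) ^ i < 2 ^ t" by linarith
  then show "i \<in> {..<t}" by simp
qed

lemma append_Cons_eq_unique:
  assumes "xs @ [k] @ ys = xs' @ [k] @ ys'" "k \<notin> set xs" "k \<notin> set xs'"
  shows "xs = xs' \<and> ys = ys'"
  using assms by (auto simp: append_eq_append_conv2 append_eq_Cons_conv Cons_eq_append_conv)

text \<open>The words in \<open>u_prod A\<close> only have letters up to \<open>t\<close>, so the
  first \<open>Suc t\<close> fixes the cut. The lengths of the two sides then determine the sets
  through their binary digits. This evaluates the \<open>THE\<close> in \<open>left_set\<close> and
  \<open>right_set\<close>.\<close>

lemma zimin_decomp_iff:
  assumes "zimin_factor (xs @ [Suc t] @ ys)" "\<forall>x\<in>set xs \<union> set ys. x \<le> t"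
  shows "max_letter (xs @ [Suc t] @ ys) = Suc t"
    "zimin_decomp (xs @ [Suc t] @ ys) p \<longleftrightarrow>
      p = (Suc ` set_decode (length xs), Suc ` set_decode (length ys))"
proof -
  let ?u = "xs @ [Suc t] @ ys"
  note split = zimin_factor_split[OF assms]
  show max: "max_letter ?u = Suc t"
    unfolding max_letter_def using assms(2) by (intro Max_eqI) (auto simp: le_Suc_eq)
  have xs: "u_prod (Suc ` set_decode (length xs)) = xs"
    using split(1) by (simp add: u_prod_Suc_image)
  have ys: "v_prod (Suc ` set_decode (length ys)) = ys"
    using split(2) by (simp add: v_prod_Suc_image)
  have sub: "Suc ` set_decode (length xs) \<subseteq> {1..<Suc t}" "Suc ` set_decode (length ys) \<subseteq> {1..<Suc t}"
    using set_decode_subset_lessThan split by fastforce+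
  obtain A B where p: "p = (A, B)" by (cases p)
  have "A = Suc ` set_decode (length xs) \<and> B = Suc ` set_decode (length ys)"
    if "zimin_decomp ?u (A, B)"
  proof -
    have AB: "A \<subseteq> {1..<Suc t}" "B \<subseteq> {1..<Suc t}" "?u = u_prod A @ [Suc t] @ v_prod B"
      using that unfolding zimin_decomp_def max by auto
    have fin: "finite A" "finite B" using AB finite_subset by blast+
    obtain A' B' where A': "A = Suc ` A'" "B = Suc ` B'"
      using AB subset_imageE[of A Suc "{..<t}"] subset_imageE[of B Suc "{..<t}"]
      by (metis One_nat_def image_Suc_lessThan atLeastLessThanSuc_atLeastAtMost)
    then have fin': "finite A'" "finite B'" using fin by (auto simp: finite_image_iff)
    have "set (u_prod A) \<subseteq> {..t}"
    proof -
      have "set (u_word a) \<subseteq> {..t}" if "a \<in> A" for a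
      proof -
        obtain m where "a = Suc m" "m < t" using AB \<open>a \<in> A\<close> by (cases a) auto
        moreover have "set (zimin m) \<subseteq> {..m}" by (induction m) auto
        ultimately show ?thesis by (auto simp: u_word_Suc)
      qed
      then show ?thesis using fin by (auto simp: u_prod_def)
    qed
    then have "Suc t \<notin> set (u_prod A)" by auto
    moreover have "Suc t \<notin> set xs" using assms(2) Suc_n_not_le_n by blast
    ultimately have "xs = u_prod A" "ys = v_prod B"
      using append_Cons_eq_unique[OF AB(3)] by auto
    then have "length xs = set_encode A'" "length ys = set_encode B'"
      using fin' by (simp_all add: A' u_prod_Suc_image v_prod_Suc_image)
    then show ?thesis using fin' A' by simp
  qed
  moreover have "zimin_decomp ?u (Suc ` set_decode (length xs), Suc ` set_decode (length ys))"
    using sub xs ys unfolding zimin_decomp_def max by simp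
  ultimately show "zimin_decomp ?u p \<longleftrightarrow>
      p = (Suc ` set_decode (length xs), Suc ` set_decode (length ys))"
    unfolding p by auto
qed

text \<open>Below \<open>t\<close>, the digits of \<open>D\<close> are the complement of those of
  \<open>length xs\<close>. The leading digit \<open>e\<close> of \<open>D\<close> is thus the
  largest one missing from \<open>length xs\<close>, and red asks the \<open>e\<close> lower digits
  of the two side lengths to be complementary. The \<open>Suc\<close> in the resulting divisibility
  counts the maximal letter.\<close>

lemma zimin_coloring_factor:
  assumes "zimin_factor (xs @ [Suc t] @ ys)" "\<forall>x\<in>set xs \<union> set ys. x \<le> t"
    and D: "length xs + D + 1 = 2 ^ t" "2 ^ e \<le> D" "D < 2 ^ Suc e"
  shows "zimin_coloring (xs @ [Suc t] @ ys) = Red \<longleftrightarrow> 2 ^ e dvd length (xs @ [Suc t] @ ys)"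
proof -
  let ?u = "xs @ [Suc t] @ ys" and ?A = "set_decode (length xs)" and ?B = "set_decode (length ys)"
  have max: "max_letter ?u = Suc t" by (rule zimin_decomp_iff(1)[OF assms(1,2)])
  have "(THE p. zimin_decomp ?u p) = (Suc ` ?A, Suc ` ?B)"
    by (rule the_equality) (simp_all only: zimin_decomp_iff(2)[OF assms(1,2)])
  then have sets: "left_set ?u = Suc ` ?A" "right_set ?u = Suc ` ?B"
    by (simp_all add: left_set_def right_set_def)
  have compl: "i \<in> ?A \<longleftrightarrow> i \<notin> set_decode D" if "i < t" for i
    using set_decode_complementary_iff[of t "length xs" D] D(1) that by simp
  have "(2::nat) ^ e < 2 ^ t" using D by linarith
  then have "e < t" by simp
  have "D div 2 ^ e = 1" using D by (intro div_nat_eqI) auto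
  then have "e \<in> set_decode D" by (simp add: set_decode_def)
  then have e: "e \<notin> ?A" using compl \<open>e < t\<close> by simp
  have "i \<le> e" if "i < t" "i \<notin> ?A" for i
    using set_decode_subset_lessThan[OF D(3)] compl that by (auto simp: less_Suc_eq_le)
  then have "Max ({1..<Suc t} - Suc ` ?A) = Suc e"
    using e \<open>e < t\<close> by (intro Max_eqI) (auto simp: image_iff elim!: Suc_le_D[elim_format])
  moreover have "Suc ` ?A \<noteq> {1..<Suc t}" using e \<open>e < t\<close> by (auto simp: set_eq_iff image_iff)
  ultimately have eta: "eta ?u = Suc e" unfolding eta_def sets max by simp
  have "Suc ` ?A \<inter> {1..<Suc e} = {1..<Suc e} - (Suc ` ?B \<inter> {1..<Suc e}) \<longleftrightarrow>
      (\<forall>i<e. i \<in> ?A \<longleftrightarrow> i \<notin> ?B)"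
  proof -
    have "{1..<Suc e} = Suc ` {..<e}" by (simp add: image_Suc_lessThan atLeastLessThanSuc_atLeastAtMost)
    then have "Suc ` ?A \<inter> {1..<Suc e} = {1..<Suc e} - (Suc ` ?B \<inter> {1..<Suc e}) \<longleftrightarrow>
        Suc ` (?A \<inter> {..<e}) = Suc ` ({..<e} - (?B \<inter> {..<e}))"
      by (simp add: image_Int image_set_diff)
    also have "\<dots> \<longleftrightarrow> ?A \<inter> {..<e} = {..<e} - (?B \<inter> {..<e})"
      by (rule inj_image_eq_iff) simp
    finally show ?thesis by auto
  qed
  then show ?thesis
    using assms(1) unfolding zimin_coloring_def eta sets set_decode_complementary_iff by simp
qed

section \<open>Intervals of Z and the blocks of a factorisation\<close>

lemma zimin_word_le_if_less_power: "Suc n < 2 ^ t \<Longrightarrow> zimin_word n \<le> t"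
  using less_zimin_word_iff[of t n] by (auto simp: nat_dvd_not_less simp flip: not_less)

lemma subsequence_split:
  assumes "i \<le> j" "j \<le> k"
  shows "w [i \<rightarrow> k] = w [i \<rightarrow> j] @ w [j \<rightarrow> k]"
  using assms upt_add_eq_append[of i j "k - j"] by (simp add: subsequence_def)

lemma subsequence_split_at_power:
  assumes "a < 2 ^ t" "2 ^ t \<le> b"
  shows "zimin_word [a \<rightarrow> b] = zimin_word [a \<rightarrow> 2 ^ t - 1] @ [Suc t] @ zimin_word [2 ^ t \<rightarrow> b]"
proof -
  have "zimin_word [2 ^ t - 1 \<rightarrow> 2 ^ t] = [Suc t]"
    using zimin_word_power[of t] subsequence_singleton[of zimin_word "2 ^ t - 1"] by simp
  moreover have "zimin_word [a \<rightarrow> b] = zimin_word [a \<rightarrow> 2 ^ t - 1] @ zimin_word [2 ^ t - 1 \<rightarrow> b]"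
    using assms by (intro subsequence_split) auto
  moreover have "zimin_word [2 ^ t - 1 \<rightarrow> b] = zimin_word [2 ^ t - 1 \<rightarrow> 2 ^ t] @ zimin_word [2 ^ t \<rightarrow> b]"
    using assms by (intro subsequence_split) auto
  ultimately show ?thesis by simp
qed

text \<open>The interval has \<open>2 ^ t - 1 - a\<close> letters before its maximal letter
  \<open>Suc t\<close>. Prepending \<open>vs\<close> lengthens this side, so \<open>D\<close> drops
  from \<open>a\<close> to \<open>a - length vs\<close>.\<close>

lemma zimin_coloring_append_subsequence:
  assumes "a < 2 ^ t" "2 ^ t \<le> b" "b < 2 ^ Suc t"
    and vs: "\<forall>x\<in>set vs. x \<le> t" "zimin_factor (vs @ zimin_word [a \<rightarrow> b])"
    and D: "length vs + D = a" "2 ^ e \<le> D" "D < 2 ^ Suc e"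
  shows "zimin_coloring (vs @ zimin_word [a \<rightarrow> b]) = Red \<longleftrightarrow> 2 ^ e dvd length vs + (b - a)"
proof -
  let ?xs = "vs @ zimin_word [a \<rightarrow> 2 ^ t - 1]" and ?ys = "zimin_word [2 ^ t \<rightarrow> b]"
  have eq: "vs @ zimin_word [a \<rightarrow> b] = ?xs @ [Suc t] @ ?ys"
    using subsequence_split_at_power[OF assms(1,2)] by simp
  have "zimin_word n \<le> t" if "2 ^ t \<le> n" "n < b" for n
  proof -
    have "\<not> 2 ^ t dvd 2 ^ t + (Suc n - 2 ^ t)"
      using that assms(3) by (subst dvd_add_right_iff) (auto simp: nat_dvd_not_less)
    then show ?thesis using that less_zimin_word_iff[of t n] by simp
  qed
  then have letters: "\<forall>x\<in>set ?xs \<union> set ?ys. x \<le> t"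
    using vs(1) zimin_word_le_if_less_power[of _ t] by auto
  have "length ?xs + D + 1 = 2 ^ t" using assms(1) D(1) by simp
  then have "zimin_coloring (?xs @ [Suc t] @ ?ys) = Red \<longleftrightarrow> 2 ^ e dvd length (?xs @ [Suc t] @ ?ys)"
    using letters vs(2) D(2,3) unfolding eq by (intro zimin_coloring_factor)
  then show ?thesis unfolding eq[symmetric] by simp
qed

lemma zimin_factor_distance:
  assumes "zimin_factor (xs @ [x] @ ys @ [y] @ zs)" "e < x" "e < y"
  shows "2 ^ e dvd Suc (length ys)"
proof -
  obtain i where i: "\<And>n. n < length (xs @ [x] @ ys @ [y] @ zs)
      \<Longrightarrow> (xs @ [x] @ ys @ [y] @ zs) ! n = zimin_word (i + n)"
    using zimin_factor_nth[OF assms(1)] by blast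
  have "2 ^ e dvd Suc (i + length xs)"
    using i[of "length xs"] assms(2) less_zimin_word_iff[of e "i + length xs"] by simp
  moreover have "2 ^ e dvd Suc (i + length xs) + Suc (length ys)"
    using i[of "length xs + Suc (length ys)"] assms(3)
      less_zimin_word_iff[of e "i + length xs + Suc (length ys)"] by (simp add: nth_append add_ac)
  ultimately show ?thesis by (simp only: dvd_add_right_iff)
qed

lemma factorisation_blocks:
  assumes "factorisation (suffix k y) w"
  obtains a where "strict_mono a"
    "\<And>m n. m \<le> n \<Longrightarrow> concat (map w [m..<n]) = y [a m \<rightarrow> a n]"
proof
  \<comment> \<open>The cut before block \<open>n\<close>, counted from the start of Z instead of
    the start of the suffix.\<close>
  define a where "a n = k + length (concat (map w [0..<n]))" for n
  show mono: "strict_mono a"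
    unfolding strict_mono_Suc_iff using assms by (simp add: a_def factorisation_def)
  have pre: "concat (map w [0..<n]) = y [k \<rightarrow> a n]" for n
    using assms unfolding factorisation_def Let_def a_def by (metis add.right_neutral subsequence_shift)
  fix m n :: nat assume "m \<le> n"
  then have "a m \<le> a n" using mono by (simp add: strict_mono_less_eq)
  have "y [k \<rightarrow> a m] @ concat (map w [m..<n]) = concat (map w [0..<n])"
    using \<open>m \<le> n\<close> upt_add_eq_append[of 0 m "n - m"] by (simp flip: pre)
  also have "\<dots> = y [k \<rightarrow> a m] @ y [a m \<rightarrow> a n]"
    unfolding pre using \<open>a m \<le> a n\<close> by (intro subsequence_split) (auto simp: a_def)
  finally show "concat (map w [m..<n]) = y [a m \<rightarrow> a n]" by simp
qed

text \<open>The exponent \<open>t\<close> is read off from \<open>a n\<close> as its leading one;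
  taking \<open>n\<close> so large that \<open>a n\<close> reaches a power of 2 above
  \<open>a m\<close> forces \<open>2 ^ t\<close> above \<open>a m\<close> as well.\<close>

lemma strict_mono_crosses_power:
  fixes a :: "nat \<Rightarrow> nat"
  assumes "strict_mono a"
  obtains n t where "m < n" "a m < 2 ^ t" "2 ^ t \<le> a n" "a n < 2 ^ Suc t"
proof -
  obtain s where s: "a m < 2 ^ s" using less_exp by blast
  define n where "n = m + 2 ^ s"
  have "2 ^ s \<le> a n" using strict_mono_imp_increasing[OF assms, of n] by (simp add: n_def)
  moreover from this have "0 < a n" using zero_less_power[of "2::nat" s] by linarith
  then obtain t where t: "2 ^ t \<le> a n" "a n < 2 ^ Suc t"
    using ex_power_ivl1[of 2 "a n"] by (auto simp: Suc_le_eq)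
  ultimately have "(2::nat) ^ s < 2 ^ Suc t" by linarith
  then have "s \<le> t" by (simp only: power_strict_increasing_iff one_less_numeral_iff semiring_norm less_Suc_eq_le)
  then have "(2::nat) ^ s \<le> 2 ^ t" by (intro power_increasing) auto
  with s have "a m < 2 ^ t" by linarith
  with t that[of n t] show thesis by (simp add: n_def)
qed

section \<open>The red case\<close>

lemma not_red_factorisation:
  assumes "factorisation (suffix k zimin_word) w"
    and red: "\<And>ns. ns \<noteq> [] \<Longrightarrow> sorted_wrt (<) ns \<Longrightarrow> zimin_coloring (concat (map w ns)) = Red"
  shows False
proof -
  obtain a where a: "strict_mono a"
    and blocks: "\<And>m n. m \<le> n \<Longrightarrow> concat (map w [m..<n]) = zimin_word [a m \<rightarrow> a n]"
    using factorisation_blocks[OF assms(1)] by blast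
  define c where "c = a 1 - a 0"
  have "a 0 < a 1" using a by (simp add: strict_mono_less)
  then have "0 < c" by (simp add: c_def)
  \<comment> \<open>Late enough that \<open>a j\<close> is at least \<open>2 ^ Suc c\<close>, which
    pushes its leading exponent \<open>e'\<close> above \<open>c\<close>.\<close>
  define j where "j = Suc (2 ^ Suc c)"
  have j: "2 ^ Suc c \<le> a j" using strict_mono_imp_increasing[OF a, of j] by (simp add: j_def)
  moreover from this have "0 < a j" using zero_less_power[of "2::nat" "Suc c"] by linarith
  then obtain e' where e': "2 ^ e' \<le> a j" "a j < 2 ^ Suc e'"
    using ex_power_ivl1[of 2 "a j"] by (auto simp: Suc_le_eq)
  ultimately have "(2::nat) ^ Suc c < 2 ^ Suc e'" by linarith
  then have "c < e'" by simp
  \<comment> \<open>Because \<open>c < 2 ^ e\<close>, the leading exponent of \<open>a j - c\<close>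
    is at least \<open>e\<close>, one less than that of \<open>a j\<close>. Hence
    \<open>2 ^ e\<close> divides both red lengths, whichever exponent \<open>a j - c\<close>
    has.\<close>
  then obtain e where e: "e' = Suc e" "c \<le> e" by (cases e') auto
  have "c < 2 ^ e" using e(2) less_exp[of e] by linarith
  obtain n t where n: "j < n" "a j < 2 ^ t" "2 ^ t \<le> a n" "a n < 2 ^ Suc t"
    using strict_mono_crosses_power[OF a] by blast
  have "a 1 \<le> a j" "a j < a n" using a n by (auto simp: strict_mono_less strict_mono_less_eq j_def)
  let ?V = "zimin_word [a 0 \<rightarrow> a 1]" and ?W = "zimin_word [a j \<rightarrow> a n]"
  have factors: "zimin_factor ?V" "zimin_factor ?W"
    using \<open>a 0 < a 1\<close> \<open>a j < a n\<close> unfolding zimin_factor_def by auto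
  have "zimin_coloring (concat (map w [j..<n])) = Red"
    using n(1) by (intro red) auto
  then have W: "zimin_coloring ?W = Red" using blocks n(1) by simp
  have "zimin_coloring (concat (map w ([0..<1] @ [j..<n]))) = Red"
    using n(1) by (intro red) (auto simp: sorted_wrt_append j_def simp del: upt_Suc)
  then have VW: "zimin_coloring (?V @ ?W) = Red"
    using blocks[of 0 1] blocks[of j n] n(1) by (simp only: map_append concat_append less_imp_le zero_le_one)
  have VW_factor: "zimin_factor (?V @ ?W)"
    using VW zimin_coloring_non_factor[of "?V @ ?W"] factors \<open>a j < a n\<close> by force
  have "2 ^ e dvd a n - a j"
    using zimin_coloring_append_subsequence[OF n(2-4), of "[]" "a j" e'] W factors e' e
    by (auto intro: dvd_trans[OF le_imp_power_dvd])
  moreover have "2 ^ e dvd c + (a n - a j)"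
  proof -
    have letters: "\<forall>x\<in>set ?V. x \<le> t"
      using \<open>a 1 \<le> a j\<close> n(2) by (auto intro!: zimin_word_le_if_less_power)
    have D: "length ?V + (a j - c) = a j"
      using \<open>a 1 \<le> a j\<close> by (simp add: c_def)
    have ge: "2 ^ e \<le> a j - c" "a j - c < 2 ^ Suc (Suc e)"
      using e' e \<open>c < 2 ^ e\<close> by auto
    show ?thesis
    proof (cases "a j - c < 2 ^ Suc e")
      case True
      then show ?thesis
        using zimin_coloring_append_subsequence[OF n(2-4) letters VW_factor D ge(1)] VW by (simp add: c_def)
    next
      case False
      then have "2 ^ Suc e \<le> a j - c" by simp
      from zimin_coloring_append_subsequence[OF n(2-4) letters VW_factor D this ge(2)]
      have "2 ^ Suc e dvd c + (a n - a j)" using VW by (simp add: c_def)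
      then show ?thesis by (meson dvd_trans le_imp_power_dvd lessI less_imp_le)
    qed
  qed
  ultimately have "2 ^ e dvd c" by (simp add: dvd_add_left_iff)
  then show False using \<open>0 < c\<close> \<open>c < 2 ^ e\<close> by (simp add: nat_dvd_not_less)
qed

section \<open>The blue case\<close>

text \<open>Omitting the stretch from \<open>s\<close> to \<open>s'\<close> brings the letters
  \<open>Suc e\<close> and \<open>Suc e'\<close>, originally at positions \<open>2 ^ e\<close> and
  \<open>2 ^ e'\<close>, closer by \<open>s' - s\<close>. Their distance is then no multiple of
  \<open>2 ^ e\<close>, contrary to \<open>zimin_factor_distance\<close>.\<close>

lemma not_zimin_factor_glued:
  assumes "2 ^ e \<le> s" "s \<le> s'" "s' < 2 ^ e'" "e \<le> e'" "\<not> 2 ^ e dvd s' - s"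
  shows "\<not> zimin_factor (xs @ zimin_word [2 ^ e - 1 \<rightarrow> s] @ zimin_word [s' \<rightarrow> 2 ^ e' - 1] @ [Suc e'] @ zs)"
proof
  assume *: "zimin_factor (xs @ zimin_word [2 ^ e - 1 \<rightarrow> s] @ zimin_word [s' \<rightarrow> 2 ^ e' - 1] @ [Suc e'] @ zs)"
  have "zimin_word [2 ^ e - 1 \<rightarrow> s] = [Suc e] @ zimin_word [2 ^ e \<rightarrow> s]"
    using subsequence_split_at_power[of "2 ^ e - 1" e s] assms by simp
  with * have "2 ^ e dvd Suc (length (zimin_word [2 ^ e \<rightarrow> s] @ zimin_word [s' \<rightarrow> 2 ^ e' - 1]))"
    using assms by (intro zimin_factor_distance[of xs "Suc e" _ "Suc e'" zs]) auto
  also have "\<dots> = (s - 2 ^ e) + (2 ^ e' - s')" using assms by simp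
  finally have "2 ^ e dvd (s - 2 ^ e) + (2 ^ e' - s') + 2 ^ e" by simp
  moreover have "(s' - s) + ((s - 2 ^ e) + (2 ^ e' - s') + 2 ^ e) = 2 ^ e'" using assms by simp
  moreover have "(2::nat) ^ e dvd 2 ^ e'" using assms(4) by (rule le_imp_power_dvd)
  ultimately have "2 ^ e dvd s' - s" by (metis dvd_add_left_iff)
  with assms(5) show False by simp
qed

lemma not_blue_factorisation:
  assumes "factorisation (suffix k zimin_word) w"
    and blue: "\<And>ns. ns \<noteq> [] \<Longrightarrow> sorted_wrt (<) ns \<Longrightarrow> zimin_coloring (concat (map w ns)) = Blue"
  shows False
proof -
  obtain a where a: "strict_mono a"
    and blocks: "\<And>m n. m \<le> n \<Longrightarrow> concat (map w [m..<n]) = zimin_word [a m \<rightarrow> a n]"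
    using factorisation_blocks[OF assms(1)] by blast
  obtain n1 t1 where 1: "0 < n1" "a 0 < 2 ^ t1" "2 ^ t1 \<le> a n1" "a n1 < 2 ^ Suc t1"
    using strict_mono_crosses_power[OF a] by blast
  obtain n2 t2 where 2: "n1 < n2" "a n1 < 2 ^ t2" "2 ^ t2 \<le> a n2" "a n2 < 2 ^ Suc t2"
    using strict_mono_crosses_power[OF a] by blast
  obtain n3 t3 where 3: "n2 < n3" "a n2 < 2 ^ t3" "2 ^ t3 \<le> a n3" "a n3 < 2 ^ Suc t3"
    using strict_mono_crosses_power[OF a] by blast
  obtain n4 t4 where 4: "n3 < n4" "a n3 < 2 ^ t4" "2 ^ t4 \<le> a n4" "a n4 < 2 ^ Suc t4"
    using strict_mono_crosses_power[OF a] by blast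
  obtain n5 t5 where 5: "n4 < n5" "a n4 < 2 ^ t5" "2 ^ t5 \<le> a n5" "a n5 < 2 ^ Suc t5"
    using strict_mono_crosses_power[OF a] by blast
  \<comment> \<open>With nothing prepended, \<open>D\<close> is the starting cut \<open>a m\<close>.
    Used for the omitted second and fourth groups, whose starting cuts have leading exponents
    \<open>t1\<close> and \<open>t3\<close>.\<close>
  have gap: "\<not> 2 ^ e dvd a n - a m"
    if "m < n" "2 ^ e \<le> a m" "a m < 2 ^ Suc e" "a m < 2 ^ t" "2 ^ t \<le> a n" "a n < 2 ^ Suc t" for m n e t
  proof -
    have "zimin_coloring (concat (map w [m..<n])) = Blue" using that by (intro blue) auto
    then have "zimin_coloring (zimin_word [a m \<rightarrow> a n]) \<noteq> Red" using blocks that(1) by simp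
    moreover have "zimin_factor (zimin_word [a m \<rightarrow> a n])"
      using that unfolding zimin_factor_def by auto
    ultimately show ?thesis
      using zimin_coloring_append_subsequence[of "a m" t "a n" "[]" "a m" e] that by simp
  qed
  have less: "a n1 < a n2" "a n3 < a n4" using a 2 4 by (auto simp: strict_mono_less)
  have "(2::nat) ^ t1 < 2 ^ t3" using 1 2 3 less by linarith
  then have "t1 < t3" by simp
  have "(2::nat) ^ t3 < 2 ^ t5" using 3 4 5 less by linarith
  then have "t3 < t5" by simp
  \<comment> \<open>The three kept groups, split near their largest powers of 2: \<open>?W1\<close>
    starts with the letter \<open>Suc t1\<close>, while \<open>?L\<close> and \<open>?W5\<close>
    stop just before \<open>Suc t3\<close> and \<open>Suc t5\<close>.\<close>
  let ?X = "zimin_word [a 0 \<rightarrow> 2 ^ t1 - 1]"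
  let ?W1 = "zimin_word [2 ^ t1 - 1 \<rightarrow> a n1]"
  let ?L = "zimin_word [a n2 \<rightarrow> 2 ^ t3 - 1]" and ?R = "zimin_word [2 ^ t3 \<rightarrow> a n3]"
  let ?W5 = "zimin_word [a n4 \<rightarrow> 2 ^ t5 - 1]" and ?Y = "zimin_word [2 ^ t5 \<rightarrow> a n5]"
  let ?U = "?X @ ?W1 @ ?L @ [Suc t3] @ ?R @ ?W5 @ [Suc t5] @ ?Y"
  have "zimin_coloring (concat (map w ([0..<n1] @ [n2..<n3] @ [n4..<n5]))) = Blue"
    using 1 2 3 4 5 by (intro blue) (auto simp: sorted_wrt_append)
  moreover have "concat (map w ([0..<n1] @ [n2..<n3] @ [n4..<n5])) = ?U"
  proof -
    have "zimin_word [a 0 \<rightarrow> a n1] = ?X @ ?W1"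
      using 1 by (intro subsequence_split) auto
    then show ?thesis
      using blocks[of 0 n1] blocks[of n2 n3] blocks[of n4 n5] 1(1) 3(1) 5(1)
        subsequence_split_at_power[OF 3(2,3)] subsequence_split_at_power[OF 5(2,3)] by simp
  qed
  ultimately have blue_U: "zimin_coloring ?U = Blue" by simp
  have left: "\<not> zimin_factor (?X @ ?W1 @ ?L @ [Suc t3] @ zs)" for zs
    using 1 2 3 less \<open>t1 < t3\<close> gap[of n1 n2 t1 t2] by (intro not_zimin_factor_glued) auto
  have right: "\<not> zimin_factor (us @ [Suc t3] @ ?R @ ?W5 @ [Suc t5] @ ?Y)" for us
  proof -
    have "zimin_word [2 ^ t3 - 1 \<rightarrow> a n3] = [Suc t3] @ ?R"
      using subsequence_split_at_power[of "2 ^ t3 - 1" t3 "a n3"] 3 by simp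
    then show ?thesis
      using not_zimin_factor_glued[of t3 "a n3" "a n4" t5 us ?Y] 3 4 5 less \<open>t3 < t5\<close>
        gap[of n3 n4 t3 t4] by simp
  qed
  have "\<not> zimin_factor ?U" by (rule left)
  then obtain f g where fg: "zimin_factor f" "zimin_factor g" "?U = f @ g"
    using zimin_coloring_non_factor[of ?U] blue_U by auto
  \<comment> \<open>The middle letter \<open>Suc t3\<close> lies in \<open>g\<close> or in
    \<open>f\<close>: in the first case \<open>g\<close> also contains \<open>Suc t5\<close>, in the
    second \<open>f\<close> also contains \<open>Suc t1\<close>.\<close>
  have "f @ g = (?X @ ?W1 @ ?L) @ ([Suc t3] @ ?R @ ?W5 @ [Suc t5] @ ?Y)"
    using fg(3) by simp
  then consider us where "f @ us = ?X @ ?W1 @ ?L" "g = us @ [Suc t3] @ ?R @ ?W5 @ [Suc t5] @ ?Y"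
    | zs where "f = ?X @ ?W1 @ ?L @ [Suc t3] @ zs"
    unfolding append_eq_append_conv2[of f g] by (auto simp: append_eq_Cons_conv)
  then show False using fg left right by cases auto
qed

theorem theorem3:
  shows "\<not> (\<exists>k w. factorisation (suffix k zimin_word) w \<and> super_monochromatic zimin_coloring w)"
proof (intro notI, elim exE conjE)
  fix k w
  assume w: "factorisation (suffix k zimin_word) w" "super_monochromatic zimin_coloring w"
  from w(2) obtain c where
    "\<And>ns. ns \<noteq> [] \<Longrightarrow> sorted_wrt (<) ns \<Longrightarrow> zimin_coloring (concat (map w ns)) = c"
    unfolding super_monochromatic_def by blast
  with w(1) show False
    by (cases c) (auto intro: not_red_factorisation not_blue_factorisation)
qed

end
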